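(* For $h\ge1$ put $U_h=\begin{pmatrix}1&h\\0&1\end{pmatrix}$. Let $B_1,B_2\in SL_2(\mathbb Z)$ be noncentral finite-order matrices, and suppose that $B_1B_2$ is conjugate to $U_h$ for some $h\ge1$. Up to simultaneous conjugacy, reversal of the parabolic orientation, and interchange of the two elliptic factors, precisely the following cases occur (listed with the orders of $B_1,B_2$ and $h$): Type A $(3,4;h=1)$: $B_1=\begin{pmatrix}-1&1\\-1&0\end{pmatrix}$, $B_2=\begin{pmatrix}0&-1\\1&0\end{pmatrix}$; Type B $(4,6;h=1)$: $B_1=\begin{pmatrix}0&1\\-1&0\end{pmatrix}$, $B_2=\begin{pmatrix}0&-1\\1&1\end{pmatrix}$; Type C $(3,6;h=2)$: $B_1=\begin{pmatrix}-1&1\\-1&0\end{pmatrix}$, $B_2=\begin{pmatrix}0&-1\\1&1\end{pmatrix}$. The products $B_1B_2$ in the first two cases are $U_1$, and the product in the third is $U_2$. In particular, no width $h>2$ occurs.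
   Context: Reversal of the parabolic orientation means replacing the oriented cusp generator (the product $B_1B_2$) by its inverse, so that $U_h$ is replaced by $U_{-h}$ before renormalizing the width to be positive. *)

theory Defs
  imports "HOL-Analysis.Analysis" "HOL-Algebra.Multiplicative_Group"
begin

text \<open>
  \<open>mat2 a b c d\<close> is the matrix with rows \<open>(a, b)\<close> and \<open>(c, d)\<close>.
\<close>

definition mat2 :: "int \<Rightarrow> int \<Rightarrow> int \<Rightarrow> int \<Rightarrow> int^2^2" where
  "mat2 a b c d = vector [vector [a, b], vector [c, d]]"

definition SL2Z :: "(int^2^2) monoid" where
  "SL2Z = \<lparr>carrier = {A. det A = 1}, mult = (**), one = mat 1\<rparr>"

lemma mat2_mult:
  "mat2 a b c d ** mat2 a' b' c' d' =
     mat2 (a * a' + b * c') (a * b' + b * d') (c * a' + d * c') (c * b' + d * d')"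
  by (simp add: mat2_def matrix_matrix_mult_def vec_eq_iff forall_2 sum_2)

lemma mat2_one: "mat 1 = mat2 1 0 0 1"
  by (simp add: mat2_def mat_def vec_eq_iff forall_2)

lemma det_mat2: "det (mat2 a b c d) = a * d - b * c"
  by (simp add: mat2_def det_2)

lemma mat2_surj: "A = mat2 (A$1$1) (A$1$2) (A$2$1) (A$2$2)"
  by (simp add: mat2_def vec_eq_iff forall_2)

lemma group_SL2Z: "group SL2Z"
proof (rule groupI)
  fix A assume A: "A \<in> carrier SL2Z"
  let ?B = "mat2 (A$2$2) (- A$1$2) (- A$2$1) (A$1$1)"
  have d: "A$1$1 * A$2$2 - A$1$2 * A$2$1 = 1"
    using A by (simp add: SL2Z_def det_2)
  have "?B ** A = mat 1"
    by (subst (5) mat2_surj, unfold mat2_mult mat2_one) (use d in \<open>simp add: algebra_simps\<close>)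
  moreover have "det ?B = 1"
    using d by (simp add: det_mat2 algebra_simps)
  ultimately show "\<exists>B\<in>carrier SL2Z. B \<otimes>\<^bsub>SL2Z\<^esub> A = \<one>\<^bsub>SL2Z\<^esub>"
    by (auto simp: SL2Z_def)
qed (auto simp: SL2Z_def det_mul matrix_mul_assoc)

definition U :: "int \<Rightarrow> int^2^2" where
  "U h = mat2 1 h 0 1"

definition noncentral_finite_order :: "int^2^2 \<Rightarrow> bool" where
  "noncentral_finite_order B \<longleftrightarrow>
     B \<in> carrier SL2Z \<and>
     (\<exists>A\<in>carrier SL2Z. A \<otimes>\<^bsub>SL2Z\<^esub> B \<noteq> B \<otimes>\<^bsub>SL2Z\<^esub> A) \<and>
     (\<exists>n::nat>0. B [^]\<^bsub>SL2Z\<^esub> n = \<one>\<^bsub>SL2Z\<^esub>)"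

definition conjugate_SL2Z :: "int^2^2 \<Rightarrow> int^2^2 \<Rightarrow> bool" where
  "conjugate_SL2Z A B \<longleftrightarrow>
     (\<exists>P\<in>carrier SL2Z. P \<otimes>\<^bsub>SL2Z\<^esub> A \<otimes>\<^bsub>SL2Z\<^esub> inv\<^bsub>SL2Z\<^esub> P = B)"

definition elliptic_pair :: "int^2^2 \<Rightarrow> int^2^2 \<Rightarrow> int \<Rightarrow> bool" where
  "elliptic_pair B1 B2 h \<longleftrightarrow>
     noncentral_finite_order B1 \<and> noncentral_finite_order B2 \<and>
     h \<ge> 1 \<and> conjugate_SL2Z (B1 \<otimes>\<^bsub>SL2Z\<^esub> B2) (U h)"

text \<open>
  Passing from \<open>(B1, B2)\<close> to \<open>(B2\<inverse>, B1\<inverse>)\<close> replaces the product \<open>B1 B2\<close> by its inverse, hence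
  \<open>U h\<close> by \<open>U (- h)\<close>. The width is made positive again by conjugating with \<open>diag(1, -1)\<close>, which
  has determinant \<open>-1\<close>, is its own inverse, and maps \<open>U (- h)\<close> to \<open>U h\<close>.
\<close>

definition J :: "int^2^2" where
  "J = mat2 1 0 0 (-1)"

inductive pair_move :: "(int^2^2) \<times> (int^2^2) \<Rightarrow> (int^2^2) \<times> (int^2^2) \<Rightarrow> bool" where
  conjugation:
    "\<lbrakk>B1 \<in> carrier SL2Z; B2 \<in> carrier SL2Z; P \<in> carrier SL2Z\<rbrakk> \<Longrightarrow>
     pair_move (B1, B2)
       (P \<otimes>\<^bsub>SL2Z\<^esub> B1 \<otimes>\<^bsub>SL2Z\<^esub> inv\<^bsub>SL2Z\<^esub> P, P \<otimes>\<^bsub>SL2Z\<^esub> B2 \<otimes>\<^bsub>SL2Z\<^esub> inv\<^bsub>SL2Z\<^esub> P)"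
| interchange:
    "\<lbrakk>B1 \<in> carrier SL2Z; B2 \<in> carrier SL2Z\<rbrakk> \<Longrightarrow> pair_move (B1, B2) (B2, B1)"
| reversal:
    "\<lbrakk>B1 \<in> carrier SL2Z; B2 \<in> carrier SL2Z\<rbrakk> \<Longrightarrow>
     pair_move (B1, B2) (J ** inv\<^bsub>SL2Z\<^esub> B2 ** J, J ** inv\<^bsub>SL2Z\<^esub> B1 ** J)"

abbreviation pair_equiv :: "(int^2^2) \<times> (int^2^2) \<Rightarrow> (int^2^2) \<times> (int^2^2) \<Rightarrow> bool" where
  "pair_equiv \<equiv> equivclp pair_move"

datatype pair_type = TypeA | TypeB | TypeC

fun rep1 :: "pair_type \<Rightarrow> int^2^2" where
  "rep1 TypeA = mat2 (-1) 1 (-1) 0"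
| "rep1 TypeB = mat2 0 1 (-1) 0"
| "rep1 TypeC = mat2 (-1) 1 (-1) 0"

fun rep2 :: "pair_type \<Rightarrow> int^2^2" where
  "rep2 TypeA = mat2 0 (-1) 1 0"
| "rep2 TypeB = mat2 0 (-1) 1 1"
| "rep2 TypeC = mat2 0 (-1) 1 1"

fun type_orders :: "pair_type \<Rightarrow> nat \<times> nat" where
  "type_orders TypeA = (3, 4)"
| "type_orders TypeB = (4, 6)"
| "type_orders TypeC = (3, 6)"

fun type_width :: "pair_type \<Rightarrow> int" where
  "type_width TypeA = 1"
| "type_width TypeB = 1"
| "type_width TypeC = 2"

end

(* Conjugate so that B1 B2 = U h, and let c be the lower left entry of B1. Comparing traces
   gives c h = tr B1 - tr B2. Elliptic elements have trace -1, 0 or 1 and c is nonzero, so after an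
   interchange tr B1 < tr B2 and -c h is 1 or 2. A parity argument on det B1 excludes c = -2, so
   c = -1, and conjugation by a power of U 1 then moves B1 to the representative with the same
   trace. The types are told apart by tr B1 + tr B2, which every move preserves. *)

theory Submission
  imports Defs
begin

section \<open>Matrix computations in \<open>SL2Z\<close> and the trace invariant\<close>

interpretation SL2Z: group SL2Z
  by (rule group_SL2Z)

lemma SL2Z_cancel:
  assumes "A \<in> carrier SL2Z" "B \<in> carrier SL2Z"
  shows "A \<otimes>\<^bsub>SL2Z\<^esub> (inv\<^bsub>SL2Z\<^esub> A \<otimes>\<^bsub>SL2Z\<^esub> B) = B"
    and "inv\<^bsub>SL2Z\<^esub> A \<otimes>\<^bsub>SL2Z\<^esub> (A \<otimes>\<^bsub>SL2Z\<^esub> B) = B"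
  using assms by (simp_all flip: SL2Z.m_assoc)

text \<open>These rules turn group statements into plain matrix statements. They are deleted again
  wherever group laws such as \<open>SL2Z.m_assoc\<close> have to match.\<close>

lemma SL2Z_simps [simp]:
  "A \<otimes>\<^bsub>SL2Z\<^esub> B = A ** B"
  "\<one>\<^bsub>SL2Z\<^esub> = mat 1"
  "A \<in> carrier SL2Z \<longleftrightarrow> det A = 1"
  by (simp_all add: SL2Z_def)

lemma mat2_eq_iff:
  "mat2 a b c d = mat2 a' b' c' d' \<longleftrightarrow> a = a' \<and> b = b' \<and> c = c' \<and> d = d'"
  by (auto simp: mat2_def vec_eq_iff forall_2)

lemma mat2_cases:
  obtains a b c d where "A = mat2 a b c d"
  using mat2_surj by blast

lemma trace_mat2: "trace (mat2 a b c d) = a + d"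
  by (simp add: mat2_def trace_def sum_2)

lemma inv_mat2:
  assumes "a * d - b * c = 1"
  shows "inv\<^bsub>SL2Z\<^esub> (mat2 a b c d) = mat2 d (- b) (- c) a"
  using assms
  by (intro SL2Z.inv_equality) (auto simp: det_mat2 mat2_mult mat2_one mat2_eq_iff algebra_simps)

lemma trace_conj:
  assumes "P \<in> carrier SL2Z"
  shows "trace (P ** A ** inv\<^bsub>SL2Z\<^esub> P) = trace A"
proof -
  have "trace (P ** A ** inv\<^bsub>SL2Z\<^esub> P) = trace (inv\<^bsub>SL2Z\<^esub> P ** (P ** A))"
    by (rule trace_mul_sym)
  also have "inv\<^bsub>SL2Z\<^esub> P ** (P ** A) = A"
    using SL2Z.l_inv[OF assms] by (simp add: matrix_mul_assoc)
  finally show ?thesis .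
qed

text \<open>Inverting a matrix of determinant 1 swaps its diagonal entries, and conjugation by the
  involution \<open>J\<close> only changes the signs of the off-diagonal ones.\<close>

lemma trace_reversal:
  assumes "A \<in> carrier SL2Z"
  shows "trace (J ** inv\<^bsub>SL2Z\<^esub> A ** J) = trace A"
proof (cases A rule: mat2_cases)
  case (1 a b c d)
  with assms show ?thesis
    by (simp add: J_def inv_mat2 det_mat2 mat2_mult trace_mat2)
qed

text \<open>Interchange and reversal both swap the two traces, so their sum is the invariant to use.
  It is -1, 1 and 0 on types A, B and C.\<close>

lemma pair_equiv_trace_sum:
  assumes "pair_equiv p q"
  shows "trace (fst p) + trace (snd p) = trace (fst q) + trace (snd q)"
proof -
  have move: "trace (fst p) + trace (snd p) = trace (fst q) + trace (snd q)"
    if "pair_move p q" for p q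
    using that by cases (simp_all add: trace_conj trace_reversal)
  from assms show ?thesis
    by (induction rule: equivclp_induct) (auto dest: move)
qed

section \<open>Powers, traces and orders\<close>

fun lucas :: "int \<Rightarrow> nat \<Rightarrow> int" where
  "lucas t 0 = 0"
| "lucas t (Suc 0) = 1"
| "lucas t (Suc (Suc n)) = t * lucas t (Suc n) - lucas t n"

text \<open>\<open>lucas t\<close> is the Lucas sequence with parameters (t, 1), a rescaled
  Chebyshev sequence of the second kind. By induction |s_(n+2)| >= 2 |s_(n+1)| - |s_n| > |s_(n+1)|.
  Hence no term of positive index vanishes.\<close>

lemma lucas_strict_mono:
  assumes "\<bar>t\<bar> \<ge> 2"
  shows "\<bar>lucas t n\<bar> < \<bar>lucas t (Suc n)\<bar>"
proof (induction n)
  case (Suc n)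
  have "2 * \<bar>lucas t (Suc n)\<bar> \<le> \<bar>t * lucas t (Suc n)\<bar>"
    using assms by (simp add: abs_mult mult_right_mono)
  with Suc show ?case by simp
qed simp

(* Cayley-Hamilton: A^n = s_n A - s_(n-1) with s = lucas (trace A). *)
lemma pow_mat2:
  assumes "a * d - b * c = 1"
  shows "mat2 a b c d [^]\<^bsub>SL2Z\<^esub> Suc n =
    mat2 (lucas (a + d) (Suc n) * a - lucas (a + d) n) (lucas (a + d) (Suc n) * b)
         (lucas (a + d) (Suc n) * c) (lucas (a + d) (Suc n) * d - lucas (a + d) n)"
proof (induction n)
  case 0
  show ?case by (simp add: mat2_one mat2_mult)
next
  case (Suc n)
  have bc: "b * c = a * d - 1" using assms by simp
  \<comment> \<open>The determinant relation, in the shapes in which the matrix product yields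
    \<open>b * c\<close> behind a Lucas coefficient.\<close>
  have *: "x * b * c = x * (a * d - 1)" "x * c * b = x * (a * d - 1)" for x
    by (simp_all add: bc[symmetric] mult_ac)
  have "mat2 a b c d [^]\<^bsub>SL2Z\<^esub> Suc (Suc n) = (mat2 a b c d [^]\<^bsub>SL2Z\<^esub> Suc n) ** mat2 a b c d"
    by simp
  then show ?case
    unfolding Suc mat2_mult mat2_eq_iff lucas.simps * by (simp add: mat2_eq_iff algebra_simps bc)
qed

text \<open>For a trace of absolute value at least 2 the Lucas coefficient of A in A^(n+1) is
  nonzero, so A^(n+1) = 1 makes A scalar and therefore central.\<close>

lemma noncentral_finite_order_trace:
  assumes "noncentral_finite_order A"
  shows "\<bar>trace A\<bar> \<le> 1"
proof (rule ccontr)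
  assume large: "\<not> \<bar>trace A\<bar> \<le> 1"
  obtain a b c d where A: "A = mat2 a b c d" by (rule mat2_cases)
  have det: "a * d - b * c = 1"
    using assms by (simp add: noncentral_finite_order_def A det_mat2)
  obtain n where n: "A [^]\<^bsub>SL2Z\<^esub> Suc n = mat 1"
    using assms unfolding noncentral_finite_order_def by (metis SL2Z_simps(2) gr0_implies_Suc)
  have "lucas (a + d) (Suc n) \<noteq> 0"
    using lucas_strict_mono[of "a + d" n] large by (simp add: A trace_mat2)
  moreover have "lucas (a + d) (Suc n) * (a - d) = 0" "lucas (a + d) (Suc n) * b = 0"
    "lucas (a + d) (Suc n) * c = 0"
    using n unfolding A pow_mat2[OF det] mat2_one mat2_eq_iff by (auto simp: algebra_simps)
  ultimately have scalar: "b = 0" "c = 0" "d = a" by simp_all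
  obtain B where "B ** A \<noteq> A ** B"
    using assms by (auto simp: noncentral_finite_order_def)
  then show False
    by (cases B rule: mat2_cases) (simp add: A scalar mat2_mult mat2_eq_iff mult.commute)
qed

text \<open>By \<open>pow_mat2\<close> the trace decides which powers are the identity. It suffices
  to test the claimed order and its maximal proper divisors.\<close>

lemma ord_trace:
  assumes "A \<in> carrier SL2Z"
  shows "trace A = -1 \<Longrightarrow> group.ord SL2Z A = 3"
    and "trace A = 0 \<Longrightarrow> group.ord SL2Z A = 4"
    and "trace A = 1 \<Longrightarrow> group.ord SL2Z A = 6"
proof -
  obtain a b c d where A: "A = mat2 a b c d" by (rule mat2_cases)
  have det: "a * d - b * c = 1" using assms by (simp add: A det_mat2)
  have "mat2 a b c d [^]\<^bsub>SL2Z\<^esub> Suc n = mat 1 \<longleftrightarrow> SL2Z.ord A dvd Suc n" for n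
    using SL2Z.pow_eq_id[OF assms, of "Suc n"] unfolding A SL2Z_simps by blast
  note dvd_iff = this[symmetric, unfolded pow_mat2[OF det] mat2_one mat2_eq_iff]
  have small_nat: "n = 0 \<or> n = 1 \<or> n = 2 \<or> n = 3 \<or> n = 4 \<or> n = 5 \<or> n = 6" if "n \<le> 6" for n :: nat
    using that by auto
  {
    assume t: "trace A = -1"
    \<comment> \<open>Eliminating \<open>d\<close> turns the Lucas parameter \<open>a + d\<close>
      into a numeral, so that the coefficients can be evaluated.\<close>
    have d: "d = -1 - a" using t by (simp add: A trace_mat2)
    have "SL2Z.ord A dvd 3" "\<not> SL2Z.ord A dvd 1"
      by (simp_all only: numeral_eq_Suc One_nat_def dvd_iff pred_numeral_simps) (auto simp: d numeral_eq_Suc)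
    then show "SL2Z.ord A = 3"
      using small_nat[of "SL2Z.ord A"] dvd_imp_le[of "SL2Z.ord A" 3] by fastforce
  }
  {
    assume t: "trace A = 0"
    have d: "d = - a" using t by (simp add: A trace_mat2)
    have "SL2Z.ord A dvd 4" "\<not> SL2Z.ord A dvd 2"
      by (simp_all only: numeral_eq_Suc One_nat_def dvd_iff pred_numeral_simps) (auto simp: d numeral_eq_Suc)
    then show "SL2Z.ord A = 4"
      using small_nat[of "SL2Z.ord A"] dvd_imp_le[of "SL2Z.ord A" 4] by fastforce
  }
  {
    assume t: "trace A = 1"
    have d: "d = 1 - a" using t by (simp add: A trace_mat2)
    have "SL2Z.ord A dvd 6" "\<not> SL2Z.ord A dvd 2" "\<not> SL2Z.ord A dvd 3"
      by (simp_all only: numeral_eq_Suc One_nat_def dvd_iff pred_numeral_simps) (auto simp: d numeral_eq_Suc)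
    then show "SL2Z.ord A = 6"
      using small_nat[of "SL2Z.ord A"] dvd_imp_le[of "SL2Z.ord A" 6] by fastforce
  }
qed

section \<open>The three representatives\<close>

lemma rep_trace_det:
  "det (rep1 T) = 1" "det (rep2 T) = 1"
  "(trace (rep1 T), trace (rep2 T)) =
     (case T of TypeA \<Rightarrow> (-1, 0) | TypeB \<Rightarrow> (0, 1) | TypeC \<Rightarrow> (-1, 1))"
  by (cases T; simp add: det_mat2 trace_mat2)+

lemma rep_mult: "rep1 T ** rep2 T = U (type_width T)"
  by (cases T) (simp_all add: mat2_mult U_def)

lemma ord_of_type:
  assumes "A \<in> carrier SL2Z" "B \<in> carrier SL2Z"
    and "trace A = trace (rep1 T)" "trace B = trace (rep2 T)"
  shows "(group.ord SL2Z A, group.ord SL2Z B) = type_orders T"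
  using assms rep_trace_det(3)[of T] by (cases T) (simp_all del: SL2Z_simps rep1.simps rep2.simps add: ord_trace)

text \<open>A matrix commuting with \<open>U 1\<close> has lower left entry 0, which none of the
  representatives has.\<close>

lemma rep_noncentral:
  "\<exists>A\<in>carrier SL2Z. A ** rep1 T \<noteq> rep1 T ** A"
  "\<exists>A\<in>carrier SL2Z. A ** rep2 T \<noteq> rep2 T ** A"
  by (rule bexI[of _ "U 1"]; cases T; simp add: U_def mat2_mult mat2_eq_iff det_mat2)+

lemma finite_order_rep:
  "\<exists>n::nat>0. rep1 T [^]\<^bsub>SL2Z\<^esub> n = mat 1" "\<exists>n::nat>0. rep2 T [^]\<^bsub>SL2Z\<^esub> n = mat 1"
proof -
  have ord: "(SL2Z.ord (rep1 T), SL2Z.ord (rep2 T)) = type_orders T"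
    by (rule ord_of_type) (simp_all add: rep_trace_det)
  have "rep1 T [^]\<^bsub>SL2Z\<^esub> SL2Z.ord (rep1 T) = mat 1" "rep2 T [^]\<^bsub>SL2Z\<^esub> SL2Z.ord (rep2 T) = mat 1"
    using SL2Z.pow_ord_eq_1[of "rep1 T"] SL2Z.pow_ord_eq_1[of "rep2 T"] by (simp_all add: rep_trace_det)
  \<comment> \<open>\<open>ord\<close> is 0 for elements of infinite order, so the exponent must be
    shown to be positive.\<close>
  moreover have "SL2Z.ord (rep1 T) > 0" "SL2Z.ord (rep2 T) > 0"
    using ord by (cases T; simp)+
  ultimately show "\<exists>n::nat>0. rep1 T [^]\<^bsub>SL2Z\<^esub> n = mat 1" "\<exists>n::nat>0. rep2 T [^]\<^bsub>SL2Z\<^esub> n = mat 1"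
    by blast+
qed

lemma elliptic_pair_rep: "elliptic_pair (rep1 T) (rep2 T) (type_width T)"
proof -
  have "conjugate_SL2Z (rep1 T ** rep2 T) (U (type_width T))"
    unfolding conjugate_SL2Z_def
    by (rule bexI[of _ "mat 1"]) (use SL2Z.inv_one in \<open>simp_all add: rep_mult\<close>)
  moreover have "type_width T \<ge> 1" by (cases T) simp_all
  ultimately show ?thesis
    using rep_noncentral[of T] finite_order_rep[of T]
    by (simp add: elliptic_pair_def noncentral_finite_order_def rep_trace_det)
qed

section \<open>Reduction of an elliptic pair to a representative\<close>

lemma elliptic_pair_interchange:
  assumes "elliptic_pair B1 B2 h"
  shows "elliptic_pair B2 B1 h"
proof -
  have B: "B1 \<in> carrier SL2Z" "B2 \<in> carrier SL2Z"
    using assms by (simp_all add: elliptic_pair_def noncentral_finite_order_def)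
  obtain P where P: "P \<in> carrier SL2Z"
    and conj: "P \<otimes>\<^bsub>SL2Z\<^esub> (B1 \<otimes>\<^bsub>SL2Z\<^esub> B2) \<otimes>\<^bsub>SL2Z\<^esub> inv\<^bsub>SL2Z\<^esub> P = U h"
    using assms by (auto simp: elliptic_pair_def conjugate_SL2Z_def)
  \<comment> \<open>B2 B1 = B1^-1 (B1 B2) B1, so conjugating first by B1 and then by P leads to
    \<open>U h\<close>.\<close>
  let ?Q = "P \<otimes>\<^bsub>SL2Z\<^esub> B1"
  have "?Q \<otimes>\<^bsub>SL2Z\<^esub> (B2 \<otimes>\<^bsub>SL2Z\<^esub> B1) \<otimes>\<^bsub>SL2Z\<^esub> inv\<^bsub>SL2Z\<^esub> ?Q = U h"
    unfolding conj[symmetric] using P B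
    by (simp del: SL2Z_simps add: SL2Z.inv_mult_group SL2Z.m_assoc SL2Z_cancel)
  moreover have "?Q \<in> carrier SL2Z" using P B(1) by (rule SL2Z.m_closed)
  ultimately have "conjugate_SL2Z (B2 \<otimes>\<^bsub>SL2Z\<^esub> B1) (U h)"
    unfolding conjugate_SL2Z_def by blast
  with assms show ?thesis by (simp only: elliptic_pair_def)
qed

text \<open>Conjugation by \<open>U k\<close> fixes the product \<open>U h\<close>, and once c = -1
  it shifts the upper left entry of X by -k. That entry, the trace and the determinant then fix X,
  and X together with h fixes Y.\<close>

lemma normal_form:
  assumes X: "X \<in> carrier SL2Z" and Y: "Y \<in> carrier SL2Z" and XY: "X ** Y = U h" and "h \<ge> 1"
    and "\<bar>trace X\<bar> \<le> 1" "\<bar>trace Y\<bar> \<le> 1" "trace X \<le> trace Y"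
  obtains T k where "h = type_width T"
    "U k ** X ** inv\<^bsub>SL2Z\<^esub> (U k) = rep1 T" "U k ** Y ** inv\<^bsub>SL2Z\<^esub> (U k) = rep2 T"
proof -
  obtain a b c d where X': "X = mat2 a b c d" by (rule mat2_cases)
  have det: "a * d - b * c = 1" using X by (simp add: X' det_mat2)
  have "Y = inv\<^bsub>SL2Z\<^esub> X ** U h"
    using SL2Z.inv_solve_left[OF Y X, of "U h"] X XY by (simp add: U_def det_mat2)
  then have Y': "Y = mat2 d (d * h - b) (- c) (a - c * h)"
    using det by (simp add: X' U_def inv_mat2 mat2_mult mat2_eq_iff)
  have t: "\<bar>a + d\<bar> \<le> 1" "\<bar>a + d - c * h\<bar> \<le> 1" "c * h \<le> 0"
    using assms(5-7) by (simp_all add: X' Y' trace_mat2 algebra_simps)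
  \<comment> \<open>An upper triangular X would have equal diagonal entries 1 or -1, hence trace 2
    or -2.\<close>
  have "c \<noteq> 0"
  proof
    assume "c = 0"
    then have "a * d = 1" using det by simp
    then have "a = d \<and> \<bar>a\<bar> = 1" by (auto simp: zmult_eq_1_iff)
    with t show False by auto
  qed
  with t \<open>h \<ge> 1\<close> have "c < 0"
    by (smt (verit) mult_pos_pos)
  define m where "m = - c"
  \<comment> \<open>\<open>m * h\<close> is the difference of two traces lying between -1 and
    1.\<close>
  have mh: "m \<ge> 1" "m * h \<ge> 1" "m * h \<le> 2"
    using \<open>c < 0\<close> t mult_mono[of 1 m 1 h] \<open>h \<ge> 1\<close> by (auto simp: m_def)
  have "m \<le> m * h" "h \<le> m * h"
    using mh \<open>h \<ge> 1\<close> by (simp_all add: mult_le_cancel_left1 mult_le_cancel_right1)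
  then have "m = 1 \<or> m = 2" "h = 1 \<or> h = 2"
    using mh \<open>h \<ge> 1\<close> by linarith+
  moreover have "m \<noteq> 2"
  proof
    assume "m = 2"
    then have c: "c = -2" by (simp add: m_def)
    \<comment> \<open>Here h = 1 and the traces differ by 2, so \<open>a + d\<close> is -1. But a d
      = 1 + b c is odd for even c, so a and d are both odd.\<close>
    with mh t calculation have "odd (a + d)"
      by (auto simp: m_def abs_le_iff) presburger+
    moreover have "odd (a * d)"
      using arg_cong[OF det, of odd] by (simp add: c)
    ultimately show False by simp
  qed
  ultimately have c: "c = -1" and h: "h = 1 \<or> h = 2" by (auto simp: m_def)
  have b: "b = 1 - a * d" using det by (simp add: c)
  have Uinv: "inv\<^bsub>SL2Z\<^esub> (U k) = U (- k)" for k
    by (simp add: U_def inv_mat2)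
  have conj: "U k ** X ** inv\<^bsub>SL2Z\<^esub> (U k) = mat2 (a - k) (1 - (a - k) * (d + k)) (-1) (d + k)"
    "U k ** Y ** inv\<^bsub>SL2Z\<^esub> (U k) =
       mat2 (d + k) ((d + k) * h - 1 + (a - k) * (d + k)) 1 (a - k + h)" for k
    unfolding Uinv unfolding X' Y' c b U_def by (simp_all add: mat2_mult mat2_eq_iff algebra_simps)
  \<comment> \<open>As c = -1, Y has trace \<open>a + d + h\<close>, which is at most 1.\<close>
  consider "a + d = -1" "h = 1" | "a + d = 0" "h = 1" | "a + d = -1" "h = 2"
    using t h unfolding c by force
  then show thesis
  proof cases
    case 1
    \<comment> \<open>In each case k makes the upper left entry \<open>a - k\<close> that of
      \<open>rep1\<close>: -1 for types A and C, 0 for type B.\<close>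
    show thesis by (rule that[of TypeA "a + 1"]) (use 1 in \<open>simp_all add: conj mat2_eq_iff\<close>)
  next
    case 2
    show thesis by (rule that[of TypeB a]) (use 2 in \<open>simp_all add: conj mat2_eq_iff\<close>)
  next
    case 3
    show thesis by (rule that[of TypeC "a + 1"]) (use 3 in \<open>simp_all add: conj mat2_eq_iff\<close>)
  qed
qed

text \<open>Two conjugations suffice: one takes the product to \<open>U h\<close>, the other is by
  the \<open>U k\<close> of \<open>normal_form\<close>. Both preserve traces, and these determine
  the orders.\<close>

lemma elliptic_pair_ordered_type:
  assumes ell: "elliptic_pair B1 B2 h" and le: "trace B1 \<le> trace B2"
  obtains T where "pair_equiv (B1, B2) (rep1 T, rep2 T)" "h = type_width T"
    "(group.ord SL2Z B1, group.ord SL2Z B2) = type_orders T"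
proof -
  have B: "B1 \<in> carrier SL2Z" "B2 \<in> carrier SL2Z" and "h \<ge> 1"
    using ell by (simp_all add: elliptic_pair_def noncentral_finite_order_def)
  have small: "\<bar>trace B1\<bar> \<le> 1" "\<bar>trace B2\<bar> \<le> 1"
    using ell by (simp_all add: elliptic_pair_def noncentral_finite_order_trace)
  obtain P where P: "P \<in> carrier SL2Z"
    and UP: "P \<otimes>\<^bsub>SL2Z\<^esub> (B1 \<otimes>\<^bsub>SL2Z\<^esub> B2) \<otimes>\<^bsub>SL2Z\<^esub> inv\<^bsub>SL2Z\<^esub> P = U h"
    using ell by (auto simp: elliptic_pair_def conjugate_SL2Z_def)
  define X where "X = P \<otimes>\<^bsub>SL2Z\<^esub> B1 \<otimes>\<^bsub>SL2Z\<^esub> inv\<^bsub>SL2Z\<^esub> P"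
  define Y where "Y = P \<otimes>\<^bsub>SL2Z\<^esub> B2 \<otimes>\<^bsub>SL2Z\<^esub> inv\<^bsub>SL2Z\<^esub> P"
  have XY: "X \<in> carrier SL2Z" "Y \<in> carrier SL2Z"
    unfolding X_def Y_def using P B by (auto simp del: SL2Z_simps)
  have "X \<otimes>\<^bsub>SL2Z\<^esub> Y = U h"
    unfolding X_def Y_def UP[symmetric] using P B
    by (simp del: SL2Z_simps add: SL2Z.m_assoc SL2Z_cancel)
  moreover have tr: "trace X = trace B1" "trace Y = trace B2"
    using trace_conj[OF P] by (simp_all add: X_def Y_def)
  ultimately obtain T k where T: "h = type_width T"
    and k: "U k ** X ** inv\<^bsub>SL2Z\<^esub> (U k) = rep1 T" "U k ** Y ** inv\<^bsub>SL2Z\<^esub> (U k) = rep2 T"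
    using normal_form[OF XY] \<open>h \<ge> 1\<close> small le by (metis SL2Z_simps(1))
  have Uk: "U k \<in> carrier SL2Z" by (simp add: U_def det_mat2)
  have "pair_move (B1, B2) (X, Y)"
    unfolding X_def Y_def by (rule conjugation) (fact B P)+
  moreover have "pair_move (X, Y) (rep1 T, rep2 T)"
    using conjugation[OF XY Uk] k by simp
  ultimately have "pair_equiv (B1, B2) (rep1 T, rep2 T)"
    by (meson equivclp_trans r_into_equivclp)
  moreover have "trace B1 = trace (rep1 T)" "trace B2 = trace (rep2 T)"
    using trace_conj[OF Uk] tr by (simp_all flip: k)
  ultimately show thesis
    using that T ord_of_type[OF B] by blast
qed

text \<open>If the traces are in the wrong order, one interchange corrects this; hence the two
  alternatives for the orders.\<close>

lemma elliptic_pair_type: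
  assumes "elliptic_pair B1 B2 h"
  obtains T where "pair_equiv (B1, B2) (rep1 T, rep2 T)" "h = type_width T"
    "(group.ord SL2Z B1, group.ord SL2Z B2) = type_orders T \<or>
     (group.ord SL2Z B2, group.ord SL2Z B1) = type_orders T"
proof (cases "trace B1 \<le> trace B2")
  case True
  with assms that show thesis by (metis elliptic_pair_ordered_type)
next
  case False
  then obtain T where T: "pair_equiv (B2, B1) (rep1 T, rep2 T)" "h = type_width T"
    "(group.ord SL2Z B2, group.ord SL2Z B1) = type_orders T"
    using elliptic_pair_ordered_type[OF elliptic_pair_interchange[OF assms]] by (metis linear)
  have "pair_move (B1, B2) (B2, B1)"
    using assms by (intro interchange) (simp_all add: elliptic_pair_def noncentral_finite_order_def)
  then have "pair_equiv (B1, B2) (rep1 T, rep2 T)"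
    using T(1) by (meson equivclp_trans r_into_equivclp)
  with T that show thesis by blast
qed

lemma pair_equiv_rep_unique:
  assumes "pair_equiv p (rep1 S, rep2 S)" "pair_equiv p (rep1 T, rep2 T)"
  shows "S = T"
  using pair_equiv_trace_sum[OF assms(1)] pair_equiv_trace_sum[OF assms(2)]
  by (cases S; cases T) (simp_all add: trace_mat2)

theorem theorem2p1:
  shows "(\<forall>T. elliptic_pair (rep1 T) (rep2 T) (type_width T) \<and>
              rep1 T \<otimes>\<^bsub>SL2Z\<^esub> rep2 T = U (type_width T) \<and>
              (group.ord SL2Z (rep1 T), group.ord SL2Z (rep2 T)) = type_orders T) \<and>
         (\<forall>B1 B2 h. elliptic_pair B1 B2 h \<longrightarrow>
              (\<exists>!T. pair_equiv (B1, B2) (rep1 T, rep2 T)) \<and>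
              (\<forall>T. pair_equiv (B1, B2) (rep1 T, rep2 T) \<longrightarrow>
                 h = type_width T \<and>
                 ((group.ord SL2Z B1, group.ord SL2Z B2) = type_orders T \<or>
                  (group.ord SL2Z B2, group.ord SL2Z B1) = type_orders T))) \<and>
         (\<forall>B1 B2 h. elliptic_pair B1 B2 h \<longrightarrow> h \<le> 2)"
proof (intro conjI allI impI)
  fix T
  show "elliptic_pair (rep1 T) (rep2 T) (type_width T)"
    by (rule elliptic_pair_rep)
  show "rep1 T \<otimes>\<^bsub>SL2Z\<^esub> rep2 T = U (type_width T)"
    by (simp add: rep_mult)
  show "(group.ord SL2Z (rep1 T), group.ord SL2Z (rep2 T)) = type_orders T"
    by (rule ord_of_type) (simp_all add: rep_trace_det)
next
  fix B1 B2 h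
  assume "elliptic_pair B1 B2 h"
  then obtain S where S: "pair_equiv (B1, B2) (rep1 S, rep2 S)" "h = type_width S"
    "(group.ord SL2Z B1, group.ord SL2Z B2) = type_orders S \<or>
     (group.ord SL2Z B2, group.ord SL2Z B1) = type_orders S"
    by (rule elliptic_pair_type)
  show "\<exists>!T. pair_equiv (B1, B2) (rep1 T, rep2 T)"
    using S(1) pair_equiv_rep_unique by blast
  show "h \<le> 2"
    using S(2) by (cases S) simp_all
  fix T
  assume "pair_equiv (B1, B2) (rep1 T, rep2 T)"
  \<comment> \<open>Uniqueness carries the width and the orders found for S over to any equivalent
    representative.\<close>
  then have "T = S" using S(1) by (rule pair_equiv_rep_unique)
  with S show "h = type_width T"
    "(group.ord SL2Z B1, group.ord SL2Z B2) = type_orders T \<or>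
     (group.ord SL2Z B2, group.ord SL2Z B1) = type_orders T"
    by blast+
qed

end
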